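(* Let $n\in\mathbb{N}$, $n\ge 1$, let $\beta\in\{-1,1\}$, let $V$ be a linear space and $W$ a Banach space. Suppose that $\phi:V^n\times V^n\to[0,\infty)$ is a mapping satisfying $$\lim_{l\to\infty}\left(\frac{1}{2^{3n\beta}}\right)^l\phi(2^{\beta l}x_1,2^{\beta l}x_2)=0$$ for all $x_1,x_2\in V^n$ and $$\Phi(x):=\frac{1}{2^{3n\frac{\beta+1}{2}+n}}\sum_{l=0}^{\infty}\left(\frac{1}{2^{3n\beta}}\right)^l\phi\left(2^{\beta l+\frac{\beta-1}{2}}x,0\right)<\infty$$ for all $x\in V^n$. Assume also that $f:V^n\to W$ is a mapping satisfying $$\|\mathfrak Df(x_1,x_2)\|\le\phi(x_1,x_2)$$ for all $x_1,x_2\in V^n$, where $$\mathfrak Df(x_1,x_2):=\sum_{q\in\{-1,1\}^n} f(2x_1+qx_2)-\sum_{k=0}^{n}2^{n-k}12^{k}f(\mathcal M_{k}^n)$$ and $f(\mathcal M_k^n)=\sum_{s} f(x_1+sx_2)$, the sum being over all $s\in\{-1,0,1\}^n$ having exactly $k$ entries equal to $0$. Then there exists a unique multi-cubic mapping $\mathcal C:V^n\to W$ such that $$\|f(x)-\mathcal C(x)\|\le\Phi(x)$$ for all $x\in V^n$.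
   Context: Linear spaces are vector spaces over $\mathbb{Q}$ (in particular, real or complex vector spaces are allowed). For $x_i=(x_{i1},\dots,x_{in})\in V^n$ ($i\in\{1,2\}$), a scalar $r$ and $t=(t_1,\dots,t_n)\in\{-1,0,1\}^n$, write $rx_1=(rx_{11},\dots,rx_{1n})$ and $tx_2=(t_1x_{21},\dots,t_nx_{2n})$; addition in $V^n$ is componentwise, and $0$ in $\phi(\cdot,0)$ is the zero of $V^n$. A mapping $\mathfrak C:V\to W$ is called cubic if $\mathfrak C(2x+y)+\mathfrak C(2x-y)=2\mathfrak C(x+y)+2\mathfrak C(x-y)+12\mathfrak C(x)$ for all $x,y\in V$. A mapping $f:V^n\to W$ is called multi-cubic if it is cubic in each variable, i.e. for each $j\in\{1,\dots,n\}$ and each choice of the other $n-1$ arguments, the resulting mapping of the $j$th argument is cubic. The quantity $f(\mathcal M_k^n)$ (depending on $x_1,x_2$) is the sum of $f(N_1,\dots,N_n)$ over all choices of $N_j\in\{x_{1j}+x_{2j},\,x_{1j}-x_{2j},\,x_{1j}\}$ in which exactly $k$ of the components are chosen to be $x_{1j}$. *)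

theory Defs
  imports "HOL-Analysis.Analysis"
begin

text \<open>
  Linear spaces are vector spaces over the rationals: \<open>sc :: rat \<Rightarrow> 'v \<Rightarrow> 'v\<close> is the scalar
  multiplication, and the definitions take it as a parameter.  The power \<open>V\<^sup>n\<close> is the type
  \<open>'v ^ 'n\<close> with \<open>n = CARD('n) \<ge> 1\<close>.
\<close>

definition vscale :: "(rat \<Rightarrow> 'v \<Rightarrow> 'v) \<Rightarrow> rat \<Rightarrow> 'v ^ 'n \<Rightarrow> 'v ^ 'n"
  where "vscale sc r x = (\<chi> j. sc r (x $ j))"

definition vmult :: "(rat \<Rightarrow> 'v \<Rightarrow> 'v) \<Rightarrow> rat ^ 'n \<Rightarrow> 'v ^ 'n \<Rightarrow> 'v ^ 'n"
  where "vmult sc t x = (\<chi> j. sc (t $ j) (x $ j))"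

definition cubic :: "(rat \<Rightarrow> 'v::ab_group_add \<Rightarrow> 'v) \<Rightarrow> ('v \<Rightarrow> 'w::real_vector) \<Rightarrow> bool"
  where "cubic sc g \<longleftrightarrow>
    (\<forall>x y. g (sc 2 x + y) + g (sc 2 x - y) = 2 *\<^sub>R g (x + y) + 2 *\<^sub>R g (x - y) + 12 *\<^sub>R g x)"

definition multi_cubic ::
    "(rat \<Rightarrow> 'v::ab_group_add \<Rightarrow> 'v) \<Rightarrow> ('v ^ 'n \<Rightarrow> 'w::real_vector) \<Rightarrow> bool"
  where "multi_cubic sc f \<longleftrightarrow> (\<forall>j x. cubic sc (\<lambda>y. f (\<chi> i. if i = j then y else x $ i)))"

definition sum_M ::
    "(rat \<Rightarrow> 'v::ab_group_add \<Rightarrow> 'v) \<Rightarrow> ('v ^ 'n \<Rightarrow> 'w::real_vector) \<Rightarrow> nat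
      \<Rightarrow> 'v ^ 'n \<Rightarrow> 'v ^ 'n \<Rightarrow> 'w"
  where "sum_M sc f k x1 x2 =
    (\<Sum>s \<in> {s :: rat ^ 'n. (\<forall>j. s $ j \<in> {-1, 0, 1}) \<and> card {j. s $ j = 0} = k}.
       f (x1 + vmult sc s x2))"

definition Dop ::
    "(rat \<Rightarrow> 'v::ab_group_add \<Rightarrow> 'v) \<Rightarrow> ('v ^ 'n \<Rightarrow> 'w::real_vector)
      \<Rightarrow> 'v ^ 'n \<Rightarrow> 'v ^ 'n \<Rightarrow> 'w"
  where "Dop sc f x1 x2 =
    (\<Sum>q \<in> {q :: rat ^ 'n. \<forall>j. q $ j \<in> {-1, 1}}. f (vscale sc 2 x1 + vmult sc q x2))
    - (\<Sum>k = 0..CARD('n). (2 ^ (CARD('n) - k) * 12 ^ k) *\<^sub>R sum_M sc f k x1 x2)"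

text \<open>The index sets of the two sums above are finite, so neither sum is 0 by convention.\<close>

lemma finite_vec_entries:
  fixes A :: "'a set"
  assumes "finite A"
  shows "finite {s :: 'a ^ 'n. \<forall>j. s $ j \<in> A}"
proof -
  have "finite (PiE (UNIV :: 'n set) (\<lambda>_. A))"
    using assms by (intro finite_PiE) auto
  moreover have "{s :: 'a ^ 'n. \<forall>j. s $ j \<in> A} \<subseteq> vec_lambda ` PiE UNIV (\<lambda>_. A)"
  proof
    fix s :: "'a ^ 'n"
    assume "s \<in> {s. \<forall>j. s $ j \<in> A}"
    then have "vec_nth s \<in> PiE UNIV (\<lambda>_. A)" by auto
    then show "s \<in> vec_lambda ` PiE UNIV (\<lambda>_. A)"
      by (metis image_eqI vec_nth_inverse)
  qed
  ultimately show ?thesis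
    by (meson finite_imageI finite_subset)
qed

text \<open>
  For \<open>\<beta> \<in> {-1, 1}\<close> the numbers \<open>\<beta> + 1\<close> and \<open>\<beta> - 1\<close> are even, so \<open>(\<beta> + 1) div 2\<close> and
  \<open>(\<beta> - 1) div 2\<close> are exact.  Since \<open>\<phi>\<close> is nonnegative, finiteness of the series
  is summability of \<open>Phi_term\<close>.
\<close>

definition Phi_term ::
    "(rat \<Rightarrow> 'v::ab_group_add \<Rightarrow> 'v) \<Rightarrow> int \<Rightarrow> ('v ^ 'n \<Rightarrow> 'v ^ 'n \<Rightarrow> real)
      \<Rightarrow> 'v ^ 'n \<Rightarrow> nat \<Rightarrow> real"
  where "Phi_term sc \<beta> \<phi> x l =
    (1 / 2 powi (3 * int CARD('n) * \<beta>)) ^ l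
      * \<phi> (vscale sc (2 powi (\<beta> * int l + (\<beta> - 1) div 2)) x) 0"

definition Phi ::
    "(rat \<Rightarrow> 'v::ab_group_add \<Rightarrow> 'v) \<Rightarrow> int \<Rightarrow> ('v ^ 'n \<Rightarrow> 'v ^ 'n \<Rightarrow> real) \<Rightarrow> 'v ^ 'n \<Rightarrow> real"
  where "Phi sc \<beta> \<phi> x =
    1 / 2 powi (3 * int CARD('n) * ((\<beta> + 1) div 2) + int CARD('n))
      * (\<Sum>l. Phi_term sc \<beta> \<phi> x l)"

end

theory Submission
  imports Defs
begin

text \<open>
  Putting \<open>x\<^sub>2 = 0\<close> in the hypothesis compares \<open>f (2 x)\<close> with \<open>8 ^ n f x\<close>, so Hyers' direct method
  yields the limit \<open>C\<close> of \<open>8 ^ (- n \<beta> l) f (2 ^ (\<beta> l) x)\<close>, within \<open>\<Phi>\<close> of \<open>f\<close>, with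
  \<open>\<DD> C = 0\<close> and \<open>C (2 x) = 8 ^ n C x\<close>.  That \<open>\<DD> C = 0\<close> makes \<open>C\<close> cubic in every variable is
  the main point.  Taking \<open>x\<^sub>2\<close> supported in the coordinate \<open>j\<close> and using the joint homogeneity, the
  fourth central differences of \<open>C\<close> in the variable \<open>j\<close> vanish, so \<open>C\<close> is a polynomial of degree
  at most 3 along the multiples of any vector, in each variable separately.  As the joint degree is
  \<open>3 n\<close>, every variable must have degree exactly 3.
\<close>

section \<open>Sums over sign vectors and \<open>Dop\<close> at axis vectors\<close>

text \<open>Split by the value \<open>a\<close> of \<open>s $ j\<close>: the weight is a product
  over coordinates, so the sum factorises, and each coordinate other than \<open>j\<close>
  contributes the total weight of \<open>A\<close>.\<close>

lemma sum_vec_entries_prod: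
  fixes w :: "'a \<Rightarrow> real" and G :: "'a \<Rightarrow> 'w::real_vector" and j :: "'n::finite"
  assumes A: "finite A"
  shows "(\<Sum>s \<in> {s :: 'a ^ 'n. \<forall>i. s $ i \<in> A}. (\<Prod>i\<in>UNIV. w (s $ i)) *\<^sub>R G (s $ j))
    = (\<Sum>a\<in>A. w a) ^ (CARD('n) - 1) *\<^sub>R (\<Sum>a\<in>A. w a *\<^sub>R G a)"
proof -
  let ?S = "{s :: 'a ^ 'n. \<forall>i. s $ i \<in> A}"
  have coeff: "(\<Sum>s\<in>?S. (\<Prod>i\<in>UNIV. w (s $ i)) * (if s $ j = a then 1 else 0))
      = (\<Sum>a\<in>A. w a) ^ (CARD('n) - 1) * w a" if "a \<in> A" for a
  proof -
    \<comment> \<open>Killing every value except \<open>a\<close> in coordinate \<open>j\<close>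
      absorbs the indicator of \<open>s $ j = a\<close> into the product.\<close>
    let ?v = "\<lambda>i b. w b * (if i = j \<and> b \<noteq> a then 0 else 1)"
    have prod_v: "(\<Prod>i\<in>UNIV. ?v i (p i)) = (\<Prod>i\<in>UNIV. w (p i)) * (if p j = a then 1 else 0)" for p
    proof (cases "p j = a")
      case True
      then show ?thesis by (auto intro!: prod.cong)
    next
      case False
      then have "?v j (p j) = 0" by simp
      then have "(\<Prod>i\<in>UNIV. ?v i (p i)) = 0"
        by (intro prod_zero) (auto intro!: bexI[of _ j])
      then show ?thesis using False by simp
    qed
    have "(\<Sum>s\<in>?S. (\<Prod>i\<in>UNIV. w (s $ i)) * (if s $ j = a then 1 else 0))
        = (\<Sum>s\<in>?S. \<Prod>i\<in>UNIV. ?v i (s $ i))"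
      by (simp only: prod_v)
    also have "\<dots> = (\<Sum>p\<in>PiE UNIV (\<lambda>_. A). \<Prod>i\<in>UNIV. ?v i (p i))"
      by (rule sum.reindex_bij_witness[where i = vec_lambda and j = vec_nth]) auto
    also have "\<dots> = (\<Prod>i\<in>UNIV. \<Sum>b\<in>A. ?v i b)"
      using A by (subst prod_sum_PiE) auto
    also have "\<dots> = (\<Sum>b\<in>A. ?v j b) * (\<Prod>i\<in>UNIV - {j}. \<Sum>b\<in>A. ?v i b)"
      by (rule prod.remove) auto
    also have "(\<Sum>b\<in>A. ?v j b) = (\<Sum>b\<in>A. if b = a then w b else 0)"
      by (intro sum.cong) auto
    also have "\<dots> = w a" using A that by simp
    also have "(\<Prod>i\<in>UNIV - {j}. \<Sum>b\<in>A. ?v i b) = (\<Prod>i\<in>UNIV - {j}. \<Sum>b\<in>A. w b)"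
      by (intro prod.cong sum.cong) auto
    also have "\<dots> = (\<Sum>b\<in>A. w b) ^ (CARD('n) - 1)"
      by (simp add: card_Diff_singleton)
    finally show ?thesis by (simp add: mult.commute)
  qed
  have "(\<Sum>s\<in>?S. (\<Prod>i\<in>UNIV. w (s $ i)) *\<^sub>R G (s $ j))
      = (\<Sum>s\<in>?S. \<Sum>a\<in>A. ((\<Prod>i\<in>UNIV. w (s $ i)) * (if s $ j = a then 1 else 0)) *\<^sub>R G a)"
  proof (rule sum.cong)
    fix s assume "s \<in> ?S"
    then have "(\<Sum>a\<in>A. if a = s $ j then G a else 0) = G (s $ j)" using A by simp
    then show "(\<Prod>i\<in>UNIV. w (s $ i)) *\<^sub>R G (s $ j)
      = (\<Sum>a\<in>A. ((\<Prod>i\<in>UNIV. w (s $ i)) * (if s $ j = a then 1 else 0)) *\<^sub>R G a)"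
      by (simp add: scaleR_scaleR[symmetric] scaleR_sum_right[symmetric] if_distrib[of "\<lambda>c. c *\<^sub>R _"]
        eq_commute[of "s $ j"] del: scaleR_scaleR cong: if_cong)
  qed simp
  also have "\<dots> = (\<Sum>a\<in>A. (\<Sum>s\<in>?S. (\<Prod>i\<in>UNIV. w (s $ i)) * (if s $ j = a then 1 else 0)) *\<^sub>R G a)"
    by (subst sum.swap) (simp only: scaleR_sum_left)
  also have "\<dots> = (\<Sum>a\<in>A. ((\<Sum>a\<in>A. w a) ^ (CARD('n) - 1) * w a) *\<^sub>R G a)"
    by (intro sum.cong arg_cong2[where f = scaleR] coeff refl)
  finally show ?thesis by (simp add: scaleR_sum_right)
qed

text \<open>Grouping by the number of zero entries: each zero entry carries a factor 12 and every
  other entry a factor 2. This is the product form needed for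
  \<open>sum_vec_entries_prod\<close>.\<close>

lemma sum_sum_M_eq:
  fixes f :: "'v::ab_group_add ^ 'n \<Rightarrow> 'w::real_vector"
  shows "(\<Sum>k = 0..CARD('n). (2 ^ (CARD('n) - k) * 12 ^ k) *\<^sub>R sum_M sc f k x1 x2)
    = (\<Sum>s \<in> {s :: rat ^ 'n. \<forall>j. s $ j \<in> {-1, 0, 1}}.
        (\<Prod>i\<in>UNIV. if s $ i = 0 then 12 else 2) *\<^sub>R f (x1 + vmult sc s x2))"
proof -
  let ?S = "{s :: rat ^ 'n. \<forall>j. s $ j \<in> {-1, 0, 1}}"
  let ?z = "\<lambda>s :: rat ^ 'n. card {j. s $ j = 0}"
  let ?h = "\<lambda>s. (2 ^ (CARD('n) - ?z s) * 12 ^ ?z s :: real) *\<^sub>R f (x1 + vmult sc s x2)"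
  have weight: "(\<Prod>i\<in>UNIV. if s $ i = 0 then 12 else 2 :: real) = 2 ^ (CARD('n) - ?z s) * 12 ^ ?z s"
    for s :: "rat ^ 'n"
  proof -
    have "- {j. s $ j = 0} = UNIV - {j. s $ j = 0}" by auto
    then have "card (- {j. s $ j = 0}) = CARD('n) - ?z s" by (simp add: card_Diff_subset)
    then show ?thesis by (simp add: prod.If_cases)
  qed
  have fin: "finite ?S" by (rule finite_vec_entries) simp
  have "(\<Sum>k = 0..CARD('n). (2 ^ (CARD('n) - k) * 12 ^ k) *\<^sub>R sum_M sc f k x1 x2)
      = (\<Sum>k = 0..CARD('n). sum ?h {s. s \<in> ?S \<and> ?z s = k})"
    unfolding sum_M_def scaleR_sum_right by (intro sum.cong) auto
  also have "\<dots> = sum ?h ?S"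
    by (rule sum.group[OF fin]) (auto intro!: card_mono)
  finally show ?thesis by (simp only: weight)
qed

lemma vmult_axis:
  assumes "\<And>r. sc r 0 = 0"
  shows "vmult sc s (axis j b) = axis j (sc (s $ j) b)"
  using assms by (simp add: vmult_def axis_def vec_eq_iff)

text \<open>Only entry \<open>j\<close> of a sign vector acts on a vector supported at
  \<open>j\<close>. Each other coordinate sums out to \<open>1 + 1 = 2\<close> in the first sum and
  to \<open>2 + 12 + 2 = 16\<close> in the second.\<close>

lemma Dop_axis:
  fixes f :: "'v::ab_group_add ^ 'n \<Rightarrow> 'w::real_vector"
  assumes "vector_space sc"
  shows "Dop sc f x (axis j b)
    = 2 ^ (CARD('n) - 1) *\<^sub>R (f (vscale sc 2 x + axis j b) + f (vscale sc 2 x - axis j b))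
      - 16 ^ (CARD('n) - 1) *\<^sub>R
          (2 *\<^sub>R f (x + axis j b) + 2 *\<^sub>R f (x - axis j b) + 12 *\<^sub>R f x)"
proof -
  interpret V: vector_space sc by fact
  have ax: "axis j (- b) = - axis j b" "axis j 0 = 0" by (auto simp: axis_def vec_eq_iff)
  have "(\<Sum>q \<in> {q :: rat ^ 'n. \<forall>j. q $ j \<in> {-1, 1}}. f (vscale sc 2 x + vmult sc q (axis j b)))
      = 2 ^ (CARD('n) - 1) *\<^sub>R (f (vscale sc 2 x + axis j b) + f (vscale sc 2 x - axis j b))"
    using sum_vec_entries_prod[of "{-1, 1 :: rat}" "\<lambda>_. 1" "\<lambda>r. f (vscale sc 2 x + axis j (sc r b))" j]
    by (simp add: vmult_axis ax add.commute)
  moreover have "(\<Sum>s \<in> {s :: rat ^ 'n. \<forall>j. s $ j \<in> {-1, 0, 1}}.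
        (\<Prod>i\<in>UNIV. if s $ i = 0 then 12 else 2) *\<^sub>R f (x + vmult sc s (axis j b)))
      = 16 ^ (CARD('n) - 1) *\<^sub>R (2 *\<^sub>R f (x + axis j b) + 2 *\<^sub>R f (x - axis j b) + 12 *\<^sub>R f x)"
    using sum_vec_entries_prod[of "{-1, 0, 1 :: rat}" "\<lambda>r. if r = 0 then 12 else 2"
        "\<lambda>r. f (x + axis j (sc r b))" j]
    by (simp add: vmult_axis ax add.commute add.left_commute)
  ultimately show ?thesis unfolding Dop_def sum_sum_M_eq by simp
qed

lemma Dop_zero_right:
  fixes f :: "'v::ab_group_add ^ 'n \<Rightarrow> 'w::real_vector"
  assumes "vector_space sc"
  shows "Dop sc f x 0 = 2 ^ CARD('n) *\<^sub>R f (vscale sc 2 x) - 16 ^ CARD('n) *\<^sub>R f x"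
proof -
  obtain m where m: "CARD('n) = Suc m"
    using not0_implies_Suc zero_less_card_finite by (metis neq0_conv)
  \<comment> \<open>The zero vector is the axis vector with entry 0 at an arbitrary coordinate, here
    \<open>undefined\<close>.\<close>
  have "axis undefined 0 = (0 :: 'v ^ 'n)" by (simp add: axis_def vec_eq_iff)
  with Dop_axis[OF assms, of f x undefined 0] show ?thesis
    by (simp add: m scaleR_add_left[symmetric] scaleR_2[symmetric] mult.commute)
qed

section \<open>Replacing one coordinate, and rescaling\<close>

text \<open>The body matches the vector inside \<open>multi_cubic\<close>, so that folding the
  definition applies there.\<close>

definition vupdate :: "'v ^ 'n \<Rightarrow> 'n \<Rightarrow> 'v \<Rightarrow> 'v ^ 'n"
  where "vupdate x j y = (\<chi> i. if i = j then y else x $ i)"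

lemma vupdate_nth [simp]: "vupdate x j y $ i = (if i = j then y else x $ i)"
  by (simp add: vupdate_def)

lemma vscale_nth [simp]: "vscale sc r x $ i = sc r (x $ i)"
  by (simp add: vscale_def)

lemma vscale_vscale:
  assumes "vector_space sc"
  shows "vscale sc r (vscale sc q x) = vscale sc (r * q) x"
proof -
  interpret V: vector_space sc by fact
  show ?thesis by (simp add: vec_eq_iff)
qed

lemma vscale_one:
  assumes "vector_space sc"
  shows "vscale sc 1 x = x"
proof -
  interpret V: vector_space sc by fact
  show ?thesis by (simp add: vec_eq_iff)
qed

section \<open>Cubic sequences and Lagrange interpolation\<close>

text \<open>The fourth forward differences vanish, so \<open>u\<close> is the restriction to the
  naturals of a polynomial of degree at most 3.\<close>

definition cubic_recurrence :: "(nat \<Rightarrow> 'w::real_vector) \<Rightarrow> bool"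
  where "cubic_recurrence u \<longleftrightarrow>
    (\<forall>k. u (k + 4) = 4 *\<^sub>R u (k + 3) - 6 *\<^sub>R u (k + 2) + 4 *\<^sub>R u (k + 1) - u k)"

text \<open>The Lagrange basis for the nodes 0, 1, 2, 3; the last branch serves
  \<open>i = 3\<close>.\<close>

definition lagrange4 :: "nat \<Rightarrow> real \<Rightarrow> real"
  where "lagrange4 i t =
    (if i = 0 then (1 - t) * (t - 2) * (t - 3) / 6
     else if i = 1 then t * (t - 2) * (t - 3) / 2
     else if i = 2 then - t * (t - 1) * (t - 3) / 2
     else t * (t - 1) * (t - 2) / 6)"

lemma lagrange4_rec:
  "lagrange4 i (t + 4) = 4 * lagrange4 i (t + 3) - 6 * lagrange4 i (t + 2)
    + 4 * lagrange4 i (t + 1) - lagrange4 i t"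
  by (simp add: lagrange4_def field_simps)

text \<open>Both sides obey the same recurrence and agree at the four nodes.\<close>

lemma cubic_recurrence_eq:
  fixes u :: "nat \<Rightarrow> 'w::real_vector"
  assumes "cubic_recurrence u"
  shows "u k = (\<Sum>i<4. lagrange4 i (real k) *\<^sub>R u i)"
proof -
  let ?p = "\<lambda>k. \<Sum>i<4. lagrange4 i (real k) *\<^sub>R u i"
  have p_rec: "?p (k + 4) = 4 *\<^sub>R ?p (k + 3) - 6 *\<^sub>R ?p (k + 2) + 4 *\<^sub>R ?p (k + 1) - ?p k" for k
    by (simp add: lagrange4_rec scaleR_sum_right sum.distrib sum_subtractf algebra_simps
        del: sum.lessThan_Suc)
  \<comment> \<open>The recurrence has order four, so the induction carries four consecutive
    values.\<close>
  have "u k = ?p k \<and> u (k + 1) = ?p (k + 1) \<and> u (k + 2) = ?p (k + 2) \<and> u (k + 3) = ?p (k + 3)"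
  proof (induction k)
    case 0
    show ?case by (simp add: lagrange4_def eval_nat_numeral)
  next
    case (Suc k)
    then have "u (k + 4) = ?p (k + 4)"
      using assms p_rec[of k] by (simp only: cubic_recurrence_def)
    then show ?case using Suc by (simp add: add.commute eval_nat_numeral del: sum.lessThan_Suc)
  qed
  then show ?thesis by blast
qed

lemma abs_lagrange4_le:
  assumes "t \<ge> 1"
  shows "\<bar>lagrange4 i t\<bar> \<le> 2 * t ^ 3"
proof -
  have lin: "\<bar>t - 1\<bar> \<le> 2 * t" "\<bar>t - 2\<bar> \<le> 2 * t" "\<bar>t - 3\<bar> \<le> 2 * t" "\<bar>t\<bar> \<le> t" "\<bar>1 - t\<bar> \<le> 2 * t"
    using assms by auto
  have three: "\<bar>a * b * c\<bar> \<le> A * B * C"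
    if "\<bar>a\<bar> \<le> A" "\<bar>b\<bar> \<le> B" "\<bar>c\<bar> \<le> C" for a b c A B C :: real
    using that by (auto simp: abs_mult intro!: mult_mono)
  have "0 \<le> t ^ 3" using assms by simp
  then show ?thesis
    using three[OF lin(5) lin(2) lin(3)] three[OF lin(4) lin(2) lin(3)]
      three[OF lin(4) lin(1) lin(3)] three[OF lin(4) lin(1) lin(2)]
    by (auto simp: lagrange4_def abs_mult power3_eq_cube)
qed

text \<open>The cubic terms of \<open>p (2 * t)\<close> and \<open>8 * p t\<close> cancel. In the
  remaining quadratics the absolute values of the coefficients add up to at most 28.\<close>

lemma abs_lagrange4_double_le:
  assumes "t \<ge> 1"
  shows "\<bar>lagrange4 i (2 * t) - 8 * lagrange4 i t\<bar> \<le> 30 * t\<^sup>2"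
proof -
  have eq: "lagrange4 i (2 * t) - 8 * lagrange4 i t =
    (if i = 0 then - 4 * t\<^sup>2 + 11 * t - 7 else if i = 1 then 10 * t\<^sup>2 - 18 * t
     else if i = 2 then - 8 * t\<^sup>2 + 9 * t else 2 * t\<^sup>2 - 2 * t)"
    by (simp add: lagrange4_def field_simps power2_eq_square)
  have "t \<le> t\<^sup>2" "1 \<le> t\<^sup>2"
    using assms by (simp_all add: self_le_power one_le_power)
  with assms show ?thesis unfolding eq by (auto simp: abs_le_iff)
qed

lemma cubic_recurrence_norm_le:
  fixes u :: "nat \<Rightarrow> 'w::real_normed_vector"
  assumes "cubic_recurrence u" "k \<ge> 1"
  shows "norm (u k) \<le> 2 * real k ^ 3 * (\<Sum>i<4. norm (u i))"
proof -
  have "norm (u k) \<le> (\<Sum>i<4. norm (lagrange4 i (real k) *\<^sub>R u i))"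
    by (subst cubic_recurrence_eq[OF assms(1)]) (rule norm_sum)
  also have "\<dots> \<le> (\<Sum>i<4. 2 * real k ^ 3 * norm (u i))"
    using abs_lagrange4_le[of "real k"] assms(2) by (intro sum_mono) (simp add: mult_right_mono)
  finally show ?thesis by (simp only: sum_distrib_left)
qed

text \<open>Gains a factor \<open>k\<close> over \<open>cubic_recurrence_norm_le\<close>; this gain
  later forces degree exactly 3 in each variable.\<close>

lemma cubic_recurrence_norm_double_le:
  fixes u :: "nat \<Rightarrow> 'w::real_normed_vector"
  assumes "cubic_recurrence u" "k \<ge> 1"
  shows "norm (u (2 * k) - 8 *\<^sub>R u k) \<le> 30 * (real k)\<^sup>2 * (\<Sum>i<4. norm (u i))"
proof -
  have "u (2 * k) - 8 *\<^sub>R u k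
      = (\<Sum>i<4. (lagrange4 i (2 * real k) - 8 * lagrange4 i (real k)) *\<^sub>R u i)"
    unfolding cubic_recurrence_eq[OF assms(1), of "2 * k"] cubic_recurrence_eq[OF assms(1), of k]
    by (simp add: scaleR_sum_right sum_subtractf scaleR_diff_left del: sum.lessThan_Suc)
  then have "norm (u (2 * k) - 8 *\<^sub>R u k)
      \<le> (\<Sum>i<4. norm ((lagrange4 i (2 * real k) - 8 * lagrange4 i (real k)) *\<^sub>R u i))"
    by (simp only: norm_sum)
  also have "\<dots> \<le> (\<Sum>i<4. 30 * (real k)\<^sup>2 * norm (u i))"
    using abs_lagrange4_double_le[of "real k"] assms(2)
    by (intro sum_mono) (simp add: mult_right_mono)
  finally show ?thesis by (simp only: sum_distrib_left)
qed

section \<open>Growth and homogeneity in separate variables\<close>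

text \<open>Induction on \<open>J\<close>: interpolating in a new coordinate from four fixed
  multiples of its entry costs one more factor \<open>(2 ^ m) ^ 3 = 8 ^ m\<close>.\<close>

lemma separately_cubic_growth:
  fixes f :: "'v::ab_group_add ^ 'n \<Rightarrow> 'w::real_normed_vector"
  assumes rec: "\<And>x j b. cubic_recurrence (\<lambda>k. f (vupdate x j (sc (of_nat k) b)))"
  shows "\<exists>M. \<forall>m. norm (f (\<chi> i. if i \<in> J then sc (2 ^ m) (x $ i) else x $ i)) \<le> M * 8 ^ (m * card J)"
proof -
  have "finite J" by simp
  then show ?thesis
  proof (induction J arbitrary: x rule: finite_induct)
    case empty
    have "(\<chi> i. x $ i) = x" by (simp add: vec_eq_iff)
    then show ?case by (intro exI[of _ "norm (f x)"]) simp
  next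
    case (insert j J)
    let ?y = "\<lambda>J x m. \<chi> i. if i \<in> J then sc (2 ^ m) (x $ i) else x $ i"
    let ?x = "\<lambda>i. vupdate x j (sc (of_nat i) (x $ j))"
    \<comment> \<open>The bound depends on the base vector, so the induction hypothesis is taken at
      each interpolation node.\<close>
    have "\<forall>i. \<exists>M. \<forall>m. norm (f (?y J (?x i) m)) \<le> M * 8 ^ (m * card J)"
      using insert.IH by blast
    from choice[OF this] obtain M where M: "\<And>i m. norm (f (?y J (?x i) m)) \<le> M i * 8 ^ (m * card J)"
      by blast
    have "norm (f (?y (insert j J) x m)) \<le> (2 * (\<Sum>i<4. M i)) * 8 ^ (m * card (insert j J))" for m
    proof -
      have y_Suc: "?y (insert j J) x m = vupdate (?y J x m) j (sc (of_nat (2 ^ m)) (x $ j))"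
        by (auto simp: vec_eq_iff)
      have y_upd: "vupdate (?y J x m) j (sc (of_nat i) (x $ j)) = ?y J (?x i) m" for i
        using insert.hyps by (auto simp: vec_eq_iff)
      have "norm (f (?y (insert j J) x m))
          \<le> 2 * real (2 ^ m) ^ 3 * (\<Sum>i<4. norm (f (vupdate (?y J x m) j (sc (of_nat i) (x $ j)))))"
        unfolding y_Suc by (rule cubic_recurrence_norm_le[OF rec]) simp
      also have "\<dots> \<le> 2 * real (2 ^ m) ^ 3 * (\<Sum>i<4. M i * 8 ^ (m * card J))"
        unfolding y_upd by (intro mult_left_mono sum_mono M) simp
      also have "real (2 ^ m) ^ 3 = 8 ^ m"
        by (simp add: power_mult[symmetric] mult.commute[of m]) (simp add: power_mult)
      finally show ?thesis
        using insert.hyps by (simp add: sum_distrib_right[symmetric] power_add algebra_simps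
          del: sum.lessThan_Suc)
    qed
    then show ?case by blast
  qed
qed

text \<open>
  The defect \<open>h x = f (x with x\<^sub>j doubled) - 8 f x\<close> grows at most like \<open>4 ^ m * 8 ^ (m * (n - 1))\<close>
  along the points \<open>2 ^ m x\<close>, because doubling annihilates the leading coefficient of a cubic
  polynomial; but it is homogeneous of degree \<open>3 * n\<close>, so it vanishes.
\<close>
lemma separately_homogeneous:
  fixes f :: "'v::ab_group_add ^ 'n \<Rightarrow> 'w::real_normed_vector"
  assumes vs: "vector_space sc"
    and rec: "\<And>x j b. cubic_recurrence (\<lambda>k. f (vupdate x j (sc (of_nat k) b)))"
    and hom: "\<And>x. f (vscale sc 2 x) = 8 ^ CARD('n) *\<^sub>R f x"
  shows "f (vupdate x j (sc 2 (x $ j))) = 8 *\<^sub>R f x"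
proof -
  interpret V: vector_space sc by fact
  define h where "h x = f (vupdate x j (sc 2 (x $ j))) - 8 *\<^sub>R f x" for x
  have "h (vscale sc 2 x) = 8 ^ CARD('n) *\<^sub>R h x" for x
  proof -
    have "vupdate (vscale sc 2 x) j (sc 2 (vscale sc 2 x $ j)) = vscale sc 2 (vupdate x j (sc 2 (x $ j)))"
      by (simp add: vec_eq_iff)
    then show ?thesis by (simp add: h_def hom scaleR_diff_right)
  qed
  then have h_pow: "h (vscale sc (2 ^ m) x) = (8 ^ CARD('n)) ^ m *\<^sub>R h x" for m
  proof (induction m)
    case 0
    show ?case by (simp add: vscale_one[OF vs])
  next
    case (Suc m)
    then show ?case by (simp add: vscale_vscale[OF vs, symmetric])
  qed
  \<comment> \<open>Coordinate \<open>j\<close> is left out of the rescaling; it enters through its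
    multiples in \<open>?x\<close>, of which \<open>i < 4\<close> are the interpolation
    nodes.\<close>
  let ?y = "\<lambda>x m. \<chi> i. if i \<in> UNIV - {j} then sc (2 ^ m) (x $ i) else x $ i"
  let ?x = "\<lambda>i. vupdate x j (sc (of_nat i) (x $ j))"
  \<comment> \<open>From here \<open>n\<close> counts the coordinates other than
    \<open>j\<close>.\<close>
  obtain n where n: "CARD('n) = Suc n" "card (UNIV - {j}) = n"
    by (metis card_Suc_Diff1 finite UNIV_I)
  have "\<forall>i. \<exists>M. \<forall>m. norm (f (?y (?x i) m)) \<le> M * 8 ^ (m * card (UNIV - {j}))"
    using separately_cubic_growth[of f sc, OF rec] by blast
  from choice[OF this] obtain M where M: "\<And>i m. norm (f (?y (?x i) m)) \<le> M i * 8 ^ (m * n)"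
    unfolding n by blast
  \<comment> \<open>Exact homogeneity gives \<open>8 ^ m * 8 ^ (m * n)\<close> on the left, growth
    only \<open>4 ^ m * 8 ^ (m * n)\<close> on the right; the quotient \<open>2 ^ m\<close>
    remains.\<close>
  have bound: "2 ^ m * norm (h x) \<le> 30 * (\<Sum>i<4. M i)" for m
  proof -
    have y1: "vscale sc (2 ^ m) x = vupdate (?y x m) j (sc (of_nat (2 ^ m)) (x $ j))"
      by (simp add: vec_eq_iff)
    have y2: "vupdate (vscale sc (2 ^ m) x) j (sc 2 (vscale sc (2 ^ m) x $ j))
      = vupdate (?y x m) j (sc (of_nat (2 * 2 ^ m)) (x $ j))"
      by (simp add: vec_eq_iff)
    have y_upd: "vupdate (?y x m) j (sc (of_nat i) (x $ j)) = ?y (?x i) m" for i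
      by (auto simp: vec_eq_iff)
    have "(8 ^ m * 8 ^ (m * n)) * norm (h x) = norm (h (vscale sc (2 ^ m) x))"
      unfolding h_pow by (simp add: n power_mult[symmetric] power_add[symmetric] mult.commute)
    also have "\<dots> = norm (f (vupdate (?y x m) j (sc (of_nat (2 * 2 ^ m)) (x $ j)))
        - 8 *\<^sub>R f (vupdate (?y x m) j (sc (of_nat (2 ^ m)) (x $ j))))"
      unfolding h_def y2 by (simp only: y1)
    also have "\<dots> \<le> 30 * (real (2 ^ m))\<^sup>2 * (\<Sum>i<4. norm (f (vupdate (?y x m) j (sc (of_nat i) (x $ j)))))"
      by (rule cubic_recurrence_norm_double_le[OF rec]) simp
    also have "\<dots> \<le> 30 * (real (2 ^ m))\<^sup>2 * (\<Sum>i<4. M i * 8 ^ (m * n))"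
      unfolding y_upd by (intro mult_left_mono sum_mono M) simp
    also have "(real (2 ^ m))\<^sup>2 = 4 ^ m"
      by (simp add: power_mult[symmetric] mult.commute[of m]) (simp add: power_mult)
    also have "30 * 4 ^ m * (\<Sum>i<4. M i * 8 ^ (m * n)) = (4 ^ m * 8 ^ (m * n)) * (30 * (\<Sum>i<4. M i))"
      by (simp add: sum_distrib_right[symmetric] del: sum.lessThan_Suc)
    also have "(8 :: real) ^ m = 4 ^ m * 2 ^ m" by (simp add: power_mult_distrib[symmetric])
    finally have "(4 ^ m * 8 ^ (m * n)) * (2 ^ m * norm (h x)) \<le> (4 ^ m * 8 ^ (m * n)) * (30 * (\<Sum>i<4. M i))"
      by (simp only: mult_ac)
    then show ?thesis by (rule mult_left_le_imp_le) simp
  qed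
  have "norm (h x) = 0"
  proof (rule ccontr)
    assume "norm (h x) \<noteq> 0"
    then have pos: "norm (h x) > 0" by simp
    obtain m where "30 * (\<Sum>i<4. M i) / norm (h x) < 2 ^ m"
      using real_arch_pow[of 2] by auto
    with pos bound[of m] show False by (simp add: field_simps)
  qed
  then show ?thesis by (simp add: h_def)
qed

section \<open>From \<open>Dop\<close> equal to zero to cubicity in each variable\<close>

text \<open>\<open>eight\<close> is an equation in variable \<open>j\<close> alone. It yields the
  recurrence, hence homogeneity of degree 3 in each variable, and this converts \<open>eight\<close>
  itself into the cubic equation.\<close>

lemma multi_cubic_if_Dop_zero:
  fixes f :: "'v::ab_group_add ^ 'n \<Rightarrow> 'w::real_normed_vector"
  assumes vs: "vector_space sc"
    and zero: "\<And>x1 x2. Dop sc f x1 x2 = 0"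
  shows "multi_cubic sc f"
proof -
  interpret V: vector_space sc by fact
  obtain n where n: "CARD('n) = Suc n"
    using not0_implies_Suc zero_less_card_finite by (metis neq0_conv)
  have pow: "(16 :: real) ^ k = 2 ^ k * 8 ^ k" for k by (simp add: power_mult_distrib[symmetric])
  have hom: "f (vscale sc 2 x) = 8 ^ CARD('n) *\<^sub>R f x" for x
  proof -
    have "2 ^ CARD('n) *\<^sub>R f (vscale sc 2 x) = 2 ^ CARD('n) *\<^sub>R 8 ^ CARD('n) *\<^sub>R f x"
      using Dop_zero_right[OF vs, of f x] zero[of x 0] by (simp add: pow)
    then show ?thesis by (simp only: scaleR_cancel_left) simp
  qed
  have half: "f (vscale sc 2 x + axis j b) + f (vscale sc 2 x - axis j b)
    = 8 ^ n *\<^sub>R (2 *\<^sub>R f (x + axis j b) + 2 *\<^sub>R f (x - axis j b) + 12 *\<^sub>R f x)" for x j b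
  proof -
    have "2 ^ n *\<^sub>R (f (vscale sc 2 x + axis j b) + f (vscale sc 2 x - axis j b))
      = 2 ^ n *\<^sub>R 8 ^ n *\<^sub>R (2 *\<^sub>R f (x + axis j b) + 2 *\<^sub>R f (x - axis j b) + 12 *\<^sub>R f x)"
      using Dop_axis[OF vs, of f x j b] zero[of x "axis j b"] by (simp add: pow n)
    then show ?thesis by (simp only: scaleR_cancel_left) simp
  qed
  \<comment> \<open>With \<open>sc 2 b\<close> on the axis, both arguments on the left of
    \<open>half\<close> are doubled vectors. Joint homogeneity extracts \<open>8 ^ Suc n\<close>
    there, one factor 8 more than on the right.\<close>
  have eight: "8 *\<^sub>R (f (vupdate x j (a + b)) + f (vupdate x j (a - b)))
    = 2 *\<^sub>R f (vupdate x j (a + sc 2 b)) + 2 *\<^sub>R f (vupdate x j (a - sc 2 b))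
      + 12 *\<^sub>R f (vupdate x j a)" for x j a b
  proof -
    let ?x = "vupdate x j a"
    have upd: "?x + axis j c = vupdate x j (a + c)" "?x - axis j c = vupdate x j (a - c)" for c
      by (auto simp: vec_eq_iff axis_def)
    have dbl: "vscale sc 2 ?x + axis j (sc 2 b) = vscale sc 2 (?x + axis j b)"
      "vscale sc 2 ?x - axis j (sc 2 b) = vscale sc 2 (?x - axis j b)"
      by (auto simp: vec_eq_iff axis_def V.scale_right_distrib V.scale_right_diff_distrib)
    have "8 ^ n *\<^sub>R 8 *\<^sub>R (f (vupdate x j (a + b)) + f (vupdate x j (a - b)))
      = 8 ^ n *\<^sub>R (2 *\<^sub>R f (vupdate x j (a + sc 2 b)) + 2 *\<^sub>R f (vupdate x j (a - sc 2 b))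
      + 12 *\<^sub>R f (vupdate x j a))"
      using half[of ?x j "sc 2 b"] unfolding dbl hom upd n
      by (simp add: scaleR_right_distrib mult.commute)
    then show ?thesis by (simp only: scaleR_cancel_left) simp
  qed
  have rec: "cubic_recurrence (\<lambda>k. f (vupdate x j (sc (of_nat k) b)))" for x j b
    unfolding cubic_recurrence_def
  proof
    fix k
    let ?u = "\<lambda>k. f (vupdate x j (sc (of_nat k) b))"
    \<comment> \<open>Centring \<open>eight\<close> at the multiple \<open>k + 2\<close> with step
      \<open>b\<close> reaches exactly the multiples \<open>k\<close> to
      \<open>k + 4\<close>.\<close>
    let ?a = "sc (of_nat (k + 2)) b"
    have s: "?a + b = sc (of_nat (k + 3)) b" "?a - b = sc (of_nat (k + 1)) b"
      "?a + sc 2 b = sc (of_nat (k + 4)) b" "?a - sc 2 b = sc (of_nat k) b"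
      using V.scale_left_distrib[of "of_nat (k + 2)" 1 b] V.scale_left_diff_distrib[of "of_nat (k + 2)" 1 b]
        V.scale_left_distrib[of "of_nat (k + 2)" 2 b] V.scale_left_diff_distrib[of "of_nat (k + 2)" 2 b]
      by (simp_all add: add.commute)
    have "8 *\<^sub>R (?u (k + 3) + ?u (k + 1)) = 2 *\<^sub>R ?u (k + 4) + 2 *\<^sub>R ?u k + 12 *\<^sub>R ?u (k + 2)"
      using eight[of x j ?a b] unfolding s .
    then have "2 *\<^sub>R ?u (k + 4) = 8 *\<^sub>R (?u (k + 3) + ?u (k + 1)) - 2 *\<^sub>R ?u k - 12 *\<^sub>R ?u (k + 2)"
      by simp
    also have "\<dots> = 2 *\<^sub>R (4 *\<^sub>R ?u (k + 3) - 6 *\<^sub>R ?u (k + 2) + 4 *\<^sub>R ?u (k + 1) - ?u k)"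
      by (simp add: scaleR_right_distrib scaleR_diff_right)
    finally show "?u (k + 4) = 4 *\<^sub>R ?u (k + 3) - 6 *\<^sub>R ?u (k + 2) + 4 *\<^sub>R ?u (k + 1) - ?u k"
      by (simp only: scaleR_cancel_left) simp
  qed
  have sep: "f (vupdate x j (sc 2 a)) = 8 *\<^sub>R f (vupdate x j a)" for x j a
  proof -
    have "vupdate (vupdate x j a) j c = vupdate x j c" for c by (simp add: vec_eq_iff)
    then show ?thesis using separately_homogeneous[OF vs rec hom, of "vupdate x j a" j] by simp
  qed
  show ?thesis
    unfolding multi_cubic_def cubic_def vupdate_def[symmetric]
  proof (intro allI)
    fix j x a c
    \<comment> \<open>Halving is available over the rationals and makes \<open>c\<close> the doubled
      step of \<open>eight\<close>.\<close>
    define b where "b = sc (1 / 2) c"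
    have c: "c = sc 2 b" by (simp add: b_def)
    have "f (vupdate x j (sc 2 a + c)) = 8 *\<^sub>R f (vupdate x j (a + b))"
      "f (vupdate x j (sc 2 a - c)) = 8 *\<^sub>R f (vupdate x j (a - b))"
      using sep[of x j "a + b"] sep[of x j "a - b"]
      by (simp_all add: c V.scale_right_distrib V.scale_right_diff_distrib)
    then show "f (vupdate x j (sc 2 a + c)) + f (vupdate x j (sc 2 a - c))
      = 2 *\<^sub>R f (vupdate x j (a + c)) + 2 *\<^sub>R f (vupdate x j (a - c)) + 12 *\<^sub>R f (vupdate x j a)"
      using eight[of x j a b] by (simp add: c scaleR_right_distrib)
  qed
qed

text \<open>The cubic equation with \<open>y = 0\<close> gives a factor 8 for doubling one variable;
  the coordinates are then doubled one at a time.\<close>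

lemma multi_cubic_homogeneous:
  fixes f :: "'v::ab_group_add ^ 'n \<Rightarrow> 'w::real_vector"
  assumes vs: "vector_space sc" and mc: "multi_cubic sc f"
  shows "f (vscale sc 2 x) = 8 ^ CARD('n) *\<^sub>R f x"
proof -
  interpret V: vector_space sc by fact
  have sep: "f (vupdate x j (sc 2 a)) = 8 *\<^sub>R f (vupdate x j a)" for x j a
  proof -
    let ?g = "\<lambda>y. f (vupdate x j y)"
    have "?g (sc 2 a + 0) + ?g (sc 2 a - 0) = 2 *\<^sub>R ?g (a + 0) + 2 *\<^sub>R ?g (a - 0) + 12 *\<^sub>R ?g a"
      using mc unfolding multi_cubic_def cubic_def vupdate_def[symmetric] by blast
    then have "2 *\<^sub>R ?g (sc 2 a) = 2 *\<^sub>R 8 *\<^sub>R ?g a"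
      by (simp add: scaleR_2[symmetric] scaleR_left_distrib[symmetric])
    then show ?thesis by (simp only: scaleR_cancel_left) simp
  qed
  have "f (\<chi> i. if i \<in> J then sc 2 (x $ i) else x $ i) = 8 ^ card J *\<^sub>R f x" for J
  proof -
    have "finite J" by simp
    then show ?thesis
    proof (induction J rule: finite_induct)
      case empty
      have "(\<chi> i. x $ i) = x" by (simp add: vec_eq_iff)
      then show ?case by simp
    next
      case (insert j J)
      let ?y = "\<chi> i. if i \<in> J then sc 2 (x $ i) else x $ i"
      have 1: "(\<chi> i. if i \<in> insert j J then sc 2 (x $ i) else x $ i) = vupdate ?y j (sc 2 (x $ j))"
        by (auto simp: vec_eq_iff)
      have 2: "vupdate ?y j (x $ j) = ?y" using insert.hyps by (auto simp: vec_eq_iff)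
      show ?case unfolding 1 sep 2 using insert by simp
    qed
  qed
  from this[of UNIV] show ?thesis by (simp add: vscale_def)
qed

section \<open>The direct method: existence and uniqueness\<close>

lemma Dop_tendsto:
  fixes f :: "'v::ab_group_add ^ 'n \<Rightarrow> 'w::real_normed_vector"
  assumes "\<And>x. (\<lambda>l. F l x) \<longlonglongrightarrow> f x"
  shows "(\<lambda>l. Dop sc (F l) x1 x2) \<longlonglongrightarrow> Dop sc f x1 x2"
  unfolding Dop_def sum_M_def by (intro tendsto_intros assms)

lemma Dop_scaled:
  fixes f :: "'v::ab_group_add ^ 'n \<Rightarrow> 'w::real_vector"
  assumes "vector_space sc"
  shows "Dop sc (\<lambda>x. c *\<^sub>R f (vscale sc r x)) x1 x2 = c *\<^sub>R Dop sc f (vscale sc r x1) (vscale sc r x2)"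
proof -
  interpret V: vector_space sc by fact
  have "vscale sc r (vscale sc 2 x1 + vmult sc q x2)
      = vscale sc 2 (vscale sc r x1) + vmult sc q (vscale sc r x2)"
    "vscale sc r (x1 + vmult sc q x2) = vscale sc r x1 + vmult sc q (vscale sc r x2)" for q
    by (simp_all add: vec_eq_iff vmult_def V.scale_right_distrib mult.commute)
  then show ?thesis
    unfolding Dop_def sum_M_def
    by (simp add: scaleR_diff_right scaleR_sum_right mult.commute)
qed

text \<open>For uniqueness, where the rescaled error bound becomes a tail of the series in
  \<open>Phi\<close>.\<close>

lemma suminf_tail_tendsto_zero:
  fixes g :: "nat \<Rightarrow> real"
  assumes "summable g"
  shows "(\<lambda>m. \<Sum>l. g (l + m)) \<longlonglongrightarrow> 0"
  using tendsto_diff[OF tendsto_const[of "suminf g"] summable_LIMSEQ[OF assms]]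
  by (simp add: suminf_minus_initial_segment[OF assms])

theorem theorem3p2:
  fixes sc :: "rat \<Rightarrow> 'v::ab_group_add \<Rightarrow> 'v"
    and \<beta> :: int
    and \<phi> :: "'v ^ 'n \<Rightarrow> 'v ^ 'n \<Rightarrow> real"
    and f :: "'v ^ 'n \<Rightarrow> 'w::banach"
  assumes "vector_space sc"
    and "\<beta> \<in> {-1, 1}"
    and "\<And>x1 x2. \<phi> x1 x2 \<ge> 0"
    and "\<And>x1 x2. (\<lambda>l::nat. (1 / 2 powi (3 * int CARD('n) * \<beta>)) ^ l
           * \<phi> (vscale sc (2 powi (\<beta> * int l)) x1) (vscale sc (2 powi (\<beta> * int l)) x2))
         \<longlonglongrightarrow> 0"
    and "\<And>x. summable (Phi_term sc \<beta> \<phi> x)"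
    and "\<And>x1 x2. norm (Dop sc f x1 x2) \<le> \<phi> x1 x2"
  shows "\<exists>!C :: 'v ^ 'n \<Rightarrow> 'w. multi_cubic sc C \<and> (\<forall>x. norm (f x - C x) \<le> Phi sc \<beta> \<phi> x)"
proof -
  note vs = assms(1) and summ = assms(5)
  \<comment> \<open>Both signs of \<open>\<beta>\<close> are treated together: \<open>c\<close> is
    \<open>r\<close> to the power \<open>-3 n\<close>, where \<open>n = CARD('n)\<close>, so maps
    homogeneous of degree \<open>3 n\<close> are fixed by the iteration \<open>T\<close>.
    \<open>K\<close> is the factor in front of the series in \<open>Phi\<close>.\<close>
  define r :: rat where "r = 2 powi \<beta>"
  define c :: real where "c = 1 / 2 powi (3 * int CARD('n) * \<beta>)"
  define K :: real where "K = 1 / 2 powi (3 * int CARD('n) * ((\<beta> + 1) div 2) + int CARD('n))"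
  define T where "T l x = c ^ l *\<^sub>R f (vscale sc (r ^ l) x)" for l x
  let ?P = "Phi_term sc \<beta> \<phi>"
  have c_pos: "c > 0" by (simp add: c_def)
  have r_pow: "2 powi (\<beta> * int l) = r ^ l" for l
    by (simp add: r_def power_int_mult)
  have eight: "(2 :: real) powi (3 * int CARD('n)) = 8 ^ CARD('n)"
    by (simp add: power_int_mult)
  have sixteen: "(16 :: real) ^ k = 2 ^ k * 8 ^ k" for k
    by (simp add: power_mult_distrib[symmetric])
  have beta_cases: "(\<beta> = 1 \<and> r = 2 \<and> c = 1 / 8 ^ CARD('n) \<and> K = 1 / (8 ^ CARD('n) * 2 ^ CARD('n)))
    \<or> (\<beta> = -1 \<and> r = 1 / 2 \<and> c = 8 ^ CARD('n) \<and> K = 1 / 2 ^ CARD('n))"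
    using assms(2) eight
    by (auto simp: r_def c_def K_def power_int_minus power_int_add inverse_eq_divide)
  have base: "norm (f (vscale sc 2 x) - 8 ^ CARD('n) *\<^sub>R f x) \<le> \<phi> x 0 / 2 ^ CARD('n)" for x
  proof -
    have "Dop sc f x 0 = 2 ^ CARD('n) *\<^sub>R (f (vscale sc 2 x) - 8 ^ CARD('n) *\<^sub>R f x)"
      by (simp add: Dop_zero_right[OF vs] sixteen scaleR_diff_right)
    then have "2 ^ CARD('n) * norm (f (vscale sc 2 x) - 8 ^ CARD('n) *\<^sub>R f x) \<le> \<phi> x 0"
      using assms(6)[of x 0] by simp
    then show ?thesis by (simp add: field_simps)
  qed
  \<comment> \<open>For \<open>\<beta> = 1\<close>, \<open>base\<close> is used at
    \<open>2 ^ l x\<close> and the spare factor \<open>c\<close> goes into \<open>K\<close>.\<close>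
  have step: "norm (T (Suc l) x - T l x) \<le> K * ?P x l" for l x
    using beta_cases
  proof (elim disjE conjE)
    assume *: "\<beta> = 1" "r = 2" "c = 1 / 8 ^ CARD('n)" "K = 1 / (8 ^ CARD('n) * 2 ^ CARD('n))"
    let ?x = "vscale sc (2 ^ l) x"
    have "T (Suc l) x - T l x = c ^ Suc l *\<^sub>R (f (vscale sc 2 ?x) - 8 ^ CARD('n) *\<^sub>R f ?x)"
      using * by (simp add: T_def vscale_vscale[OF vs] scaleR_diff_right)
    also have "norm \<dots> \<le> c ^ Suc l * (\<phi> ?x 0 / 2 ^ CARD('n))"
      using c_pos by (simp add: base mult_left_mono del: power_Suc times_divide_eq_right)
    also have "\<dots> = K * (c ^ l * \<phi> ?x 0)" using * by simp
    also have "c ^ l * \<phi> ?x 0 = ?P x l"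
      using * r_pow[of l] by (simp add: Phi_term_def c_def)
    finally show ?thesis .
  next
    assume *: "\<beta> = -1" "r = 1 / 2" "c = 8 ^ CARD('n)" "K = 1 / 2 ^ CARD('n)"
    \<comment> \<open>For \<open>\<beta> = -1\<close>, \<open>base\<close> is used at half of
      \<open>r ^ l x\<close>; this is the shift \<open>(\<beta> - 1) div 2 = -1\<close> in
      \<open>Phi_term\<close>.\<close>
    let ?x = "vscale sc (r ^ Suc l) x"
    have "2 * r ^ Suc l = r ^ l" using *(2) by simp
    then have dbl: "vscale sc 2 ?x = vscale sc (r ^ l) x" by (simp only: vscale_vscale[OF vs])
    have "T (Suc l) x - T l x = - (c ^ l *\<^sub>R (f (vscale sc 2 ?x) - 8 ^ CARD('n) *\<^sub>R f ?x))"
      unfolding dbl using * by (simp add: T_def scaleR_diff_right mult.commute)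
    also have "norm \<dots> \<le> c ^ l * (\<phi> ?x 0 / 2 ^ CARD('n))"
      unfolding norm_minus_cancel using c_pos
      by (simp add: base mult_left_mono del: power_Suc times_divide_eq_right)
    also have "\<dots> = K * (c ^ l * \<phi> ?x 0)" using * by simp
    also have "c ^ l * \<phi> ?x 0 = ?P x l"
    proof -
      have "\<beta> * int l + (\<beta> - 1) div 2 = \<beta> * int (Suc l)" using * by simp
      then show ?thesis using r_pow[of "Suc l"] by (simp add: Phi_term_def c_def del: of_nat_Suc power_Suc)
    qed
    finally show ?thesis .
  qed
  have summ_K: "summable (\<lambda>l. K * ?P x l)" for x using summ by (rule summable_mult)
  have T_diff: "summable (\<lambda>l. norm (T (Suc l) x - T l x))" for x
    by (rule summable_comparison_test'[OF summ_K[of x], where N = 0]) (simp add: step)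
  \<comment> \<open>Written as a telescoping series, the limit comes with its distance from
    \<open>f\<close>.\<close>
  define C where "C x = f x + (\<Sum>l. T (Suc l) x - T l x)" for x
  have T0: "T 0 x = f x" for x by (simp add: T_def vscale_one[OF vs])
  have T_lim: "(\<lambda>l. T l x) \<longlonglongrightarrow> C x" for x
  proof -
    have "(\<lambda>l. \<Sum>i<l. T (Suc i) x - T i x) \<longlonglongrightarrow> (\<Sum>l. T (Suc l) x - T l x)"
      by (rule summable_LIMSEQ[OF summable_norm_cancel[OF T_diff]])
    then have "(\<lambda>l. T l x - f x) \<longlonglongrightarrow> (\<Sum>l. T (Suc l) x - T l x)"
      unfolding sum_lessThan_telescope[of "\<lambda>l. T l x"] T0 .
    from tendsto_add[OF tendsto_const[of "f x"] this] show ?thesis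
      by (simp add: C_def)
  qed
  have C_bound: "norm (f x - C x) \<le> Phi sc \<beta> \<phi> x" for x
  proof -
    have "norm (f x - C x) = norm (\<Sum>l. T (Suc l) x - T l x)" by (simp add: C_def)
    also have "\<dots> \<le> (\<Sum>l. norm (T (Suc l) x - T l x))" by (rule summable_norm[OF T_diff])
    also have "\<dots> \<le> (\<Sum>l. K * ?P x l)" by (intro suminf_le step T_diff summ_K)
    also have "\<dots> = Phi sc \<beta> \<phi> x" unfolding Phi_def K_def by (rule suminf_mult[OF summ])
    finally show ?thesis .
  qed
  have "Dop sc C x1 x2 = 0" for x1 x2
  proof (rule LIMSEQ_unique)
    show "(\<lambda>l. Dop sc (T l) x1 x2) \<longlonglongrightarrow> Dop sc C x1 x2"
      by (intro Dop_tendsto T_lim)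
    \<comment> \<open>\<open>Dop\<close> commutes with rescaling, so the bound on
      \<open>Dop sc f\<close> becomes the sequence assumed to tend to 0.\<close>
    have bound: "norm (Dop sc (T l) x1 x2)
      \<le> c ^ l * \<phi> (vscale sc (2 powi (\<beta> * int l)) x1) (vscale sc (2 powi (\<beta> * int l)) x2)" for l
      using c_pos assms(6) by (simp add: T_def[abs_def] Dop_scaled[OF vs] r_pow mult_left_mono)
    show "(\<lambda>l. Dop sc (T l) x1 x2) \<longlonglongrightarrow> 0"
      by (rule Lim_null_comparison[OF always_eventually[OF allI[OF bound]] assms(4)[folded c_def]])
  qed
  then have C_cubic: "multi_cubic sc C" by (rule multi_cubic_if_Dop_zero[OF vs])
  have C_unique: "C' = C" if mc: "multi_cubic sc C'" and near: "\<forall>x. norm (f x - C' x) \<le> Phi sc \<beta> \<phi> x" for C'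
  proof
    fix x
    have hom: "c *\<^sub>R C' (vscale sc r y) = C' y" for y
    proof -
      have "r = 2 \<and> c = 1 / 8 ^ CARD('n) \<or> r = 1 / 2 \<and> c = 8 ^ CARD('n)"
        using beta_cases by blast
      then show ?thesis
      proof (elim disjE conjE; hypsubst)
        show "(1 / 8 ^ CARD('n)) *\<^sub>R C' (vscale sc 2 y) = C' y"
          by (simp add: multi_cubic_homogeneous[OF vs mc])
        show "8 ^ CARD('n) *\<^sub>R C' (vscale sc (1 / 2) y) = C' y"
          by (simp add: multi_cubic_homogeneous[OF vs mc, symmetric] vscale_vscale[OF vs] vscale_one[OF vs])
      qed
    qed
    have hom_pow: "c ^ l *\<^sub>R C' (vscale sc (r ^ l) x) = C' x" for l
    proof (induction l)
      case 0
      show ?case by (simp add: vscale_one[OF vs])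
    next
      case (Suc l)
      have "c ^ Suc l *\<^sub>R C' (vscale sc (r ^ Suc l) x) = c ^ l *\<^sub>R c *\<^sub>R C' (vscale sc r (vscale sc (r ^ l) x))"
        by (simp add: vscale_vscale[OF vs] mult.commute)
      then show ?case by (simp only: hom Suc)
    qed
    \<comment> \<open>Rescaling by \<open>r ^ m\<close> and weighting by \<open>c ^ m\<close> drops
      the first \<open>m\<close> terms of the series. Hence \<open>T m x\<close> tends to
      \<open>C' x\<close> as well as to \<open>C x\<close>.\<close>
    have shift: "c ^ m * ?P (vscale sc (r ^ m) x) l = ?P x (l + m)" for l m
    proof -
      have "2 powi (\<beta> * int l + (\<beta> - 1) div 2) * r ^ m = 2 powi (\<beta> * int (l + m) + (\<beta> - 1) div 2)"
        unfolding r_pow[symmetric] by (subst power_int_add[symmetric]) (simp_all add: algebra_simps)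
      then show ?thesis
        by (simp add: Phi_term_def c_def[symmetric] vscale_vscale[OF vs] power_add)
    qed
    have bound: "norm (T m x - C' x) \<le> K * (\<Sum>l. ?P x (l + m))" for m
    proof -
      let ?y = "vscale sc (r ^ m) x"
      have "norm (T m x - C' x) = norm (c ^ m *\<^sub>R (f ?y - C' ?y))"
        by (simp add: T_def scaleR_diff_right hom_pow)
      also have "\<dots> \<le> c ^ m * Phi sc \<beta> \<phi> ?y"
        using near c_pos by (simp add: mult_left_mono)
      also have "\<dots> = K * (c ^ m * suminf (?P ?y))" by (simp add: Phi_def K_def)
      also have "c ^ m * suminf (?P ?y) = (\<Sum>l. ?P x (l + m))"
        by (subst suminf_mult[OF summ, symmetric]) (simp only: shift)
      finally show ?thesis .
    qed
    have "(\<lambda>m. K * (\<Sum>l. ?P x (l + m))) \<longlonglongrightarrow> 0"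
      using tendsto_mult_left[OF suminf_tail_tendsto_zero[OF summ[of x]], of K] by simp
    then have "(\<lambda>m. T m x - C' x) \<longlonglongrightarrow> 0"
      by (rule Lim_null_comparison[OF always_eventually[OF allI[OF bound]]])
    then have "(\<lambda>m. T m x) \<longlonglongrightarrow> C' x" by (rule LIM_zero_cancel)
    with T_lim show "C' x = C x" using LIMSEQ_unique by blast
  qed
  show ?thesis
    using C_cubic C_bound C_unique by blast
qed

end
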